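(* Let $p,q\in V$ be two distinct variables. Then (i) $\{p,\neg p\}\not\vdash_{\mathbf{vD}}q$; (ii) $\{\circ p,p\}\not\vdash_{\mathbf{vD}}q$; (iii) $\{\circ p,\neg p\}\not\vdash_{\mathbf{vD}}q$.
   Context: Let $V$ be a denumerable set of propositional variables and $\mathcal{L}$ the set of formulas generated from $V$ by the binary connectives $\land,\lor,\longrightarrow$ and the unary connectives $\neg,\circ$. Fix a formula $\beta_0$ and set $\bot:=\beta_0\land(\neg\beta_0\land\circ\beta_0)$; for every formula $\alpha$ let $\sim\alpha$ abbreviate $\alpha\longrightarrow\bot$. The logic $\mathbf{vD}$ has axiom schemas (for all $\alpha,\beta,\gamma$, $\to$ denoting $\longrightarrow$): (1) $\alpha\to(\beta\to\alpha)$; (2) $(\alpha\to(\beta\to\gamma))\to((\alpha\to\beta)\to(\alpha\to\gamma))$; (3) $\alpha\to(\beta\to(\alpha\land\beta))$; (4) $(\alpha\land\beta)\to\alpha$; (5) $(\alpha\land\beta)\to\beta$; (6) $\alpha\to(\alpha\lor\beta)$; (7) $\beta\to(\alpha\lor\beta)$; (8) $(\alpha\to\beta)\lor\alpha$; (9) $\alpha\lor\neg\alpha$; (10) $(\alpha\to\gamma)\to((\neg\alpha\to\gamma)\to((\alpha\lor\neg\alpha)\to\gamma))$; (11) $((\alpha\to\beta)\to\gamma)\to((\alpha\to\gamma)\to(((\alpha\to\beta)\lor\alpha)\to\gamma))$; (12) $\circ\alpha\to(\alpha\to(\neg\alpha\to\beta))$; (13) $\circ\alpha\lor(\alpha\land\neg\alpha)$;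 (14) $(\circ\alpha\to\gamma)\to(((\alpha\land\neg\alpha)\to\gamma)\to((\circ\alpha\lor(\alpha\land\neg\alpha))\to\gamma))$; (15) $\sim\neg\alpha\to\sim\neg\sim\neg\alpha$; (16) $\sim\neg\sim\neg\alpha\to\sim\neg\alpha$; (17) $\sim\neg(\alpha\land\beta)\to(\sim\neg\alpha\land\sim\neg\beta)$; (18) $(\sim\neg\alpha\land\sim\neg\beta)\to\sim\neg(\alpha\land\beta)$; rules: (MP) from $\alpha$, $\alpha\longrightarrow\beta$ infer $\beta$; (N) from $\alpha$ infer $\neg\alpha\longrightarrow\sim\alpha$, applicable only when $\alpha$ is a theorem. A derivation of $\varphi$ from $\Gamma$ is a finite sequence ending in $\varphi$ each member of which is an axiom instance, a member of $\Gamma$, obtained by MP from earlier members, or obtained by (N) from an earlier member that is a theorem (derivable from $\emptyset$). $\Gamma\vdash_{\mathbf{vD}}\varphi$ iff such a derivation exists. *)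

theory Defs
  imports Main "HOL-Library.Countable" "HOL-Library.Infinite_Typeclass"
begin

datatype 'v fm =
    Var 'v
  | Conj "'v fm" "'v fm"  (infixr "\<^bold>\<and>" 75)
  | Disj "'v fm" "'v fm"  (infixr "\<^bold>\<or>" 70)
  | Imp "'v fm" "'v fm"  (infixr "\<^bold>\<longrightarrow>" 65)
  | Neg "'v fm"  ("\<^bold>\<not> _" [80] 80)
  | Circ "'v fm"  ("\<^bold>\<circ> _" [80] 80)

text \<open>The formula \<open>b\<close> below is the arbitrary but fixed formula \<open>\<beta>\<^sub>0\<close> from which falsum, and hence
  the defined negation \<open>\<sim>\<close>, are built.\<close>

definition falsum :: "'v fm \<Rightarrow> 'v fm" where
  "falsum b = b \<^bold>\<and> (\<^bold>\<not> b \<^bold>\<and> \<^bold>\<circ> b)"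

definition sneg :: "'v fm \<Rightarrow> 'v fm \<Rightarrow> 'v fm" where
  "sneg b \<alpha> = \<alpha> \<^bold>\<longrightarrow> falsum b"

inductive vD_axiom :: "'v fm \<Rightarrow> 'v fm \<Rightarrow> bool" for b :: "'v fm" where
  Ax1: "vD_axiom b (\<alpha> \<^bold>\<longrightarrow> (\<beta> \<^bold>\<longrightarrow> \<alpha>))"
| Ax2: "vD_axiom b ((\<alpha> \<^bold>\<longrightarrow> (\<beta> \<^bold>\<longrightarrow> \<gamma>)) \<^bold>\<longrightarrow> ((\<alpha> \<^bold>\<longrightarrow> \<beta>) \<^bold>\<longrightarrow> (\<alpha> \<^bold>\<longrightarrow> \<gamma>)))"
| Ax3: "vD_axiom b (\<alpha> \<^bold>\<longrightarrow> (\<beta> \<^bold>\<longrightarrow> (\<alpha> \<^bold>\<and> \<beta>)))"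
| Ax4: "vD_axiom b ((\<alpha> \<^bold>\<and> \<beta>) \<^bold>\<longrightarrow> \<alpha>)"
| Ax5: "vD_axiom b ((\<alpha> \<^bold>\<and> \<beta>) \<^bold>\<longrightarrow> \<beta>)"
| Ax6: "vD_axiom b (\<alpha> \<^bold>\<longrightarrow> (\<alpha> \<^bold>\<or> \<beta>))"
| Ax7: "vD_axiom b (\<beta> \<^bold>\<longrightarrow> (\<alpha> \<^bold>\<or> \<beta>))"
| Ax8: "vD_axiom b ((\<alpha> \<^bold>\<longrightarrow> \<beta>) \<^bold>\<or> \<alpha>)"
| Ax9: "vD_axiom b (\<alpha> \<^bold>\<or> \<^bold>\<not> \<alpha>)"
| Ax10: "vD_axiom b ((\<alpha> \<^bold>\<longrightarrow> \<gamma>) \<^bold>\<longrightarrow> ((\<^bold>\<not> \<alpha> \<^bold>\<longrightarrow> \<gamma>) \<^bold>\<longrightarrow> ((\<alpha> \<^bold>\<or> \<^bold>\<not> \<alpha>) \<^bold>\<longrightarrow> \<gamma>)))"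
| Ax11: "vD_axiom b (((\<alpha> \<^bold>\<longrightarrow> \<beta>) \<^bold>\<longrightarrow> \<gamma>) \<^bold>\<longrightarrow> ((\<alpha> \<^bold>\<longrightarrow> \<gamma>) \<^bold>\<longrightarrow> (((\<alpha> \<^bold>\<longrightarrow> \<beta>) \<^bold>\<or> \<alpha>) \<^bold>\<longrightarrow> \<gamma>)))"
| Ax12: "vD_axiom b (\<^bold>\<circ> \<alpha> \<^bold>\<longrightarrow> (\<alpha> \<^bold>\<longrightarrow> (\<^bold>\<not> \<alpha> \<^bold>\<longrightarrow> \<beta>)))"
| Ax13: "vD_axiom b (\<^bold>\<circ> \<alpha> \<^bold>\<or> (\<alpha> \<^bold>\<and> \<^bold>\<not> \<alpha>))"
| Ax14: "vD_axiom b ((\<^bold>\<circ> \<alpha> \<^bold>\<longrightarrow> \<gamma>) \<^bold>\<longrightarrow> (((\<alpha> \<^bold>\<and> \<^bold>\<not> \<alpha>) \<^bold>\<longrightarrow> \<gamma>) \<^bold>\<longrightarrow> ((\<^bold>\<circ> \<alpha> \<^bold>\<or> (\<alpha> \<^bold>\<and> \<^bold>\<not> \<alpha>)) \<^bold>\<longrightarrow> \<gamma>)))"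
| Ax15: "vD_axiom b (sneg b (\<^bold>\<not> \<alpha>) \<^bold>\<longrightarrow> sneg b (\<^bold>\<not> (sneg b (\<^bold>\<not> \<alpha>))))"
| Ax16: "vD_axiom b (sneg b (\<^bold>\<not> (sneg b (\<^bold>\<not> \<alpha>))) \<^bold>\<longrightarrow> sneg b (\<^bold>\<not> \<alpha>))"
| Ax17: "vD_axiom b (sneg b (\<^bold>\<not> (\<alpha> \<^bold>\<and> \<beta>)) \<^bold>\<longrightarrow> (sneg b (\<^bold>\<not> \<alpha>) \<^bold>\<and> sneg b (\<^bold>\<not> \<beta>)))"
| Ax18: "vD_axiom b ((sneg b (\<^bold>\<not> \<alpha>) \<^bold>\<and> sneg b (\<^bold>\<not> \<beta>)) \<^bold>\<longrightarrow> sneg b (\<^bold>\<not> (\<alpha> \<^bold>\<and> \<beta>)))"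

text \<open>\<open>derivation b \<Gamma> xs\<close>: every member of the sequence \<open>xs\<close> is an axiom, a hypothesis, or follows
  from earlier members. In rule \<open>N\<close> the sequence \<open>ys @ [\<alpha>]\<close> witnesses that the earlier member \<open>\<alpha>\<close>
  is a theorem; this reference to derivations from the empty set is why \<open>\<Gamma>\<close> is not a fixed
  parameter of the induction.\<close>

inductive derivation :: "'v fm \<Rightarrow> 'v fm set \<Rightarrow> 'v fm list \<Rightarrow> bool" for b :: "'v fm" where
  Empty: "derivation b \<Gamma> []"
| Axiom: "derivation b \<Gamma> xs \<Longrightarrow> vD_axiom b \<alpha> \<Longrightarrow> derivation b \<Gamma> (xs @ [\<alpha>])"
| Hyp: "derivation b \<Gamma> xs \<Longrightarrow> \<alpha> \<in> \<Gamma> \<Longrightarrow> derivation b \<Gamma> (xs @ [\<alpha>])"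
| MP: "derivation b \<Gamma> xs \<Longrightarrow> \<alpha> \<in> set xs \<Longrightarrow> (\<alpha> \<^bold>\<longrightarrow> \<beta>) \<in> set xs \<Longrightarrow> derivation b \<Gamma> (xs @ [\<beta>])"
| N: "derivation b \<Gamma> xs \<Longrightarrow> \<alpha> \<in> set xs \<Longrightarrow> derivation b {} (ys @ [\<alpha>]) \<Longrightarrow>
      derivation b \<Gamma> (xs @ [\<^bold>\<not> \<alpha> \<^bold>\<longrightarrow> sneg b \<alpha>])"

definition vD_derives :: "'v fm \<Rightarrow> 'v fm set \<Rightarrow> 'v fm \<Rightarrow> bool" where
  "vD_derives b \<Gamma> \<phi> \<longleftrightarrow> (\<exists>xs. derivation b \<Gamma> (xs @ [\<phi>]))"

end

theory Submission
  imports Defs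
begin

text \<open>In a Kripke model, read \<open>\<^bold>\<not> \<alpha>\<close> as ``\<open>\<alpha>\<close> fails at some accessible world'' and \<open>\<^bold>\<circ> \<alpha>\<close> as the
  classical negation of \<open>\<alpha> \<^bold>\<and> \<^bold>\<not> \<alpha>\<close>. Then falsum holds nowhere, so \<open>\<sim>\<close> is classical negation and
  \<open>\<sim>\<^bold>\<not>\<close> is the necessity operator; axiom 9 asks for reflexive frames and axiom 15 for transitive
  ones. Rule \<open>N\<close> is sound because theorems hold at every world. In the first claim \<open>p\<close> holds at a
  world that sees one where \<open>p\<close> fails; for the other two a single world, which is a classical
  valuation, suffices.\<close>

primrec sat :: "('w \<Rightarrow> 'w \<Rightarrow> bool) \<Rightarrow> ('w \<Rightarrow> 'v \<Rightarrow> bool) \<Rightarrow> 'w \<Rightarrow> 'v fm \<Rightarrow> bool" where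
  "sat R V w (Var x) \<longleftrightarrow> V w x"
| "sat R V w (\<alpha> \<^bold>\<and> \<beta>) \<longleftrightarrow> sat R V w \<alpha> \<and> sat R V w \<beta>"
| "sat R V w (\<alpha> \<^bold>\<or> \<beta>) \<longleftrightarrow> sat R V w \<alpha> \<or> sat R V w \<beta>"
| "sat R V w (\<alpha> \<^bold>\<longrightarrow> \<beta>) \<longleftrightarrow> (sat R V w \<alpha> \<longrightarrow> sat R V w \<beta>)"
| "sat R V w (\<^bold>\<not> \<alpha>) \<longleftrightarrow> (\<exists>u. R w u \<and> \<not> sat R V u \<alpha>)"
| "sat R V w (\<^bold>\<circ> \<alpha>) \<longleftrightarrow> (sat R V w \<alpha> \<longrightarrow> (\<forall>u. R w u \<longrightarrow> sat R V u \<alpha>))"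

lemma not_sat_falsum: "\<not> sat R V w (falsum b)"
  by (auto simp: falsum_def)

lemma sat_sneg: "sat R V w (sneg b \<alpha>) \<longleftrightarrow> \<not> sat R V w \<alpha>"
  by (simp add: sneg_def not_sat_falsum)

lemma sat_sneg_Neg: "sat R V w (sneg b (\<^bold>\<not> \<alpha>)) \<longleftrightarrow> (\<forall>u. R w u \<longrightarrow> sat R V u \<alpha>)"
  by (simp add: sat_sneg)

lemma vD_axiom_sound:
  assumes "reflp R" and "transp R" and "vD_axiom b \<alpha>"
  shows "sat R V w \<alpha>"
  using \<open>vD_axiom b \<alpha>\<close>
proof cases
  case (Ax9 \<alpha>)
  then show ?thesis
    using reflpD[OF \<open>reflp R\<close>, of w] by auto
next
  case (Ax15 \<alpha>)
  then show ?thesis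
    by (auto simp: sat_sneg_Neg dest: transpD[OF \<open>transp R\<close>])
next
  case (Ax16 \<alpha>)
  then show ?thesis
    by (auto simp: sat_sneg_Neg intro: reflpD[OF \<open>reflp R\<close>])
qed (auto simp: sat_sneg_Neg)

lemma derivation_sound:
  assumes "reflp R" and "transp R"
    and "derivation b \<Gamma> xs" and "\<forall>\<gamma>\<in>\<Gamma>. sat R V w \<gamma>" and "\<phi> \<in> set xs"
  shows "sat R V w \<phi>"
  using assms(3-5)
proof (induction arbitrary: w \<phi> rule: derivation.induct)
  case (Axiom \<Gamma> xs \<alpha>)
  then show ?case
    using vD_axiom_sound[OF \<open>reflp R\<close> \<open>transp R\<close>] by auto
next
  case (MP \<Gamma> xs \<alpha> \<beta>)
  have "sat R V w \<alpha>" and "sat R V w (\<alpha> \<^bold>\<longrightarrow> \<beta>)"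
    using MP.IH MP.hyps MP.prems(1) by blast+
  then have "sat R V w \<beta>"
    by simp
  then show ?case
    using MP.IH MP.prems by auto
next
  case (N \<Gamma> xs \<alpha> ys)
  have "sat R V u \<alpha>" for u
    using N.IH(2) by simp
  then have "sat R V w (\<^bold>\<not> \<alpha> \<^bold>\<longrightarrow> sneg b \<alpha>)"
    by simp
  then show ?case
    using N.IH(1) N.prems by auto
qed auto

lemma vD_derives_sound:
  assumes "reflp R" and "transp R"
    and "vD_derives b \<Gamma> \<phi>" and "\<forall>\<gamma>\<in>\<Gamma>. sat R V w \<gamma>"
  shows "sat R V w \<phi>"
proof -
  obtain xs where "derivation b \<Gamma> (xs @ [\<phi>])"
    using \<open>vD_derives b \<Gamma> \<phi>\<close> by (auto simp: vD_derives_def)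
  then show ?thesis
    using derivation_sound[OF \<open>reflp R\<close> \<open>transp R\<close>] assms(4) by fastforce
qed

theorem theorem5p2:
  fixes \<beta>\<^sub>0 :: "'v::{countable,infinite} fm" and p q :: 'v
  assumes "p \<noteq> q"
  shows "\<not> vD_derives \<beta>\<^sub>0 {Var p, \<^bold>\<not> (Var p)} (Var q) \<and>
         \<not> vD_derives \<beta>\<^sub>0 {\<^bold>\<circ> (Var p), Var p} (Var q) \<and>
         \<not> vD_derives \<beta>\<^sub>0 {\<^bold>\<circ> (Var p), \<^bold>\<not> (Var p)} (Var q)"
proof (intro conjI)
  let ?mixed = "\<lambda>w x. w \<and> x = p"
  have "\<forall>\<gamma>\<in>{Var p, \<^bold>\<not> (Var p)}. sat (\<ge>) ?mixed True \<gamma>" and "\<not> sat (\<ge>) ?mixed True (Var q)"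
    using assms by auto
  then show "\<not> vD_derives \<beta>\<^sub>0 {Var p, \<^bold>\<not> (Var p)} (Var q)"
    using vD_derives_sound[OF reflp_on_ge transp_on_ge, where V = ?mixed and w = True] by blast
next
  let ?only_p = "\<lambda>_ x. x = p"
  have "\<forall>\<gamma>\<in>{\<^bold>\<circ> (Var p), Var p}. sat (=) ?only_p () \<gamma>" and "\<not> sat (=) ?only_p () (Var q)"
    using assms by auto
  then show "\<not> vD_derives \<beta>\<^sub>0 {\<^bold>\<circ> (Var p), Var p} (Var q)"
    using vD_derives_sound[OF reflp_on_equality transp_on_equality, where V = ?only_p and w = "()"]
    by blast
next
  let ?none = "\<lambda>_ _. False"
  have "\<forall>\<gamma>\<in>{\<^bold>\<circ> (Var p), \<^bold>\<not> (Var p)}. sat (=) ?none () \<gamma>" and "\<not> sat (=) ?none () (Var q)"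
    by auto
  then show "\<not> vD_derives \<beta>\<^sub>0 {\<^bold>\<circ> (Var p), \<^bold>\<not> (Var p)} (Var q)"
    using vD_derives_sound[OF reflp_on_equality transp_on_equality, where V = ?none and w = "()"]
    by blast
qed

end
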